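(* Let $\sigma$ be a primitive substitution on a finite alphabet $\mathcal A=\{a_1,\dots,a_k\}$ with $k\ge2$, and let $w=w_0w_1w_2\ldots$ be a one-sided infinite fixed point of $\sigma$. The following are equivalent: (i) $w$ is not eventually periodic (i.e. $\sigma$ is aperiodic); (ii) there exists $1\le i\le k$ such that $C_{a_i}(X)$ is transcendental over $\mathbb{Q}(X)$; (iii) there exist $1\le i<j\le k$ such that $C_{a_i}(X)$ and $C_{a_j}(X)$ are both transcendental over $\mathbb{Q}(X)$; (iv) there exists $1\le i\le k$ such that $P_{a_i}(X)$ is transcendental over $\mathbb{Q}(X)$; (v) there exist $1\le i<j\le k$ such that $P_{a_i}(X)$ and $P_{a_j}(X)$ are both transcendental over $\mathbb{Q}(X)$.
   Context: A substitution on $\mathcal A$ is a map $\sigma$ from $\mathcal A$ to non-empty finite words over $\mathcal A$, extended to (finite and infinite) words by concatenation. Its matrix $A_\sigma$ has $(i,j)$ entry equal to the number of $a_j$ in $\sigma(a_i)$; $\sigma$ is primitive if some power of $A_\sigma$ has all entries positive. $w$ is a fixed point if $\sigma(w)=w$. A word $w$ is eventually periodic if there exist $N$, $d\ge1$ with $w_{n+d}=w_n$ for all $n\ge N$; $\sigma$ is called aperiodic if it has a one-sided infinite fixed word which is not eventually periodic. Positions are indexed from $0$. $C_{a_i}(X)=\sum_{n\ge0}1_{a_i}(w_n)X^n$, where $1_{a_i}$ is the indicator of $a_i$; for $n\ge1$, $p_i(n)$ is the position of the $n$-th occurrence of $a_i$ in $w$, and $P_{a_i}(X)=\sum_{n\ge1}p_i(n)X^n$.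 Transcendence over $\mathbb{Q}(X)$ is meant inside $\mathbb{C}((X))$. *)

theory Defs
  imports Complex_Main "HOL-Computational_Algebra.Formal_Power_Series"
    "HOL-Computational_Algebra.Polynomial_FPS" "HOL-Library.Infinite_Set"
begin

definition is_substitution :: "('a \<Rightarrow> 'a list) \<Rightarrow> bool" where
  "is_substitution \<sigma> \<longleftrightarrow> (\<forall>a. \<sigma> a \<noteq> [])"

definition subst_matrix :: "('a \<Rightarrow> 'a list) \<Rightarrow> 'a \<Rightarrow> 'a \<Rightarrow> nat" where
  "subst_matrix \<sigma> i j = count_list (\<sigma> i) j"

definition mat_mult :: "('a::finite \<Rightarrow> 'a \<Rightarrow> nat) \<Rightarrow> ('a \<Rightarrow> 'a \<Rightarrow> nat) \<Rightarrow> 'a \<Rightarrow> 'a \<Rightarrow> nat" where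
  "mat_mult A B i j = (\<Sum>l\<in>UNIV. A i l * B l j)"

fun mat_pow :: "('a::finite \<Rightarrow> 'a \<Rightarrow> nat) \<Rightarrow> nat \<Rightarrow> 'a \<Rightarrow> 'a \<Rightarrow> nat" where
  "mat_pow A 0 = (\<lambda>i j. if i = j then 1 else 0)"
| "mat_pow A (Suc n) = mat_mult A (mat_pow A n)"

definition primitive_subst :: "('a::finite \<Rightarrow> 'a list) \<Rightarrow> bool" where
  "primitive_subst \<sigma> \<longleftrightarrow> (\<exists>n>0. \<forall>i j. mat_pow (subst_matrix \<sigma>) n i j > 0)"

(* extension of sigma to one-sided infinite words w :: nat => 'a by concatenation:
   letter n of sigma(w) is letter n of sigma(w_0) ... sigma(w_n)
   (well defined since all images are non-empty) *)
definition subst_inf :: "('a \<Rightarrow> 'a list) \<Rightarrow> (nat \<Rightarrow> 'a) \<Rightarrow> nat \<Rightarrow> 'a" where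
  "subst_inf \<sigma> w n = concat (map (\<sigma> \<circ> w) [0..<Suc n]) ! n"

definition eventually_periodic :: "(nat \<Rightarrow> 'a) \<Rightarrow> bool" where
  "eventually_periodic w \<longleftrightarrow> (\<exists>N d. d \<ge> 1 \<and> (\<forall>n\<ge>N. w (n + d) = w n))"

definition char_series :: "(nat \<Rightarrow> 'a) \<Rightarrow> 'a \<Rightarrow> complex fps" where
  "char_series w a = Abs_fps (\<lambda>n. if w n = a then 1 else 0)"

(* p_a(n), n >= 1: position of the n-th occurrence of a in w (positions from 0) *)
definition occ_pos :: "(nat \<Rightarrow> 'a) \<Rightarrow> 'a \<Rightarrow> nat \<Rightarrow> nat" where
  "occ_pos w a n = enumerate {m. w m = a} (n - 1)"

definition pos_series :: "(nat \<Rightarrow> 'a) \<Rightarrow> 'a \<Rightarrow> complex fps" where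
  "pos_series w a = Abs_fps (\<lambda>n. if n = 0 then 0 else of_nat (occ_pos w a n))"

(* f is algebraic over Q(X): a nonzero polynomial in Y with coefficients in Q[X]
   (equivalently, after clearing denominators, in Q(X)) annihilates f *)
definition algebraic_over_QX :: "complex fps \<Rightarrow> bool" where
  "algebraic_over_QX f \<longleftrightarrow>
     (\<exists>p :: rat poly poly. p \<noteq> 0 \<and>
        poly (map_poly (\<lambda>q. fps_of_poly (map_poly of_rat q)) p) f = 0)"

definition transcendental_over_QX :: "complex fps \<Rightarrow> bool" where
  "transcendental_over_QX f \<longleftrightarrow> \<not> algebraic_over_QX f"

end

theory Submission
  imports Defs "HOL-Analysis.FPS_Convergence"
begin

text \<open>
  A power series f with finitely many distinct coefficients that is algebraic has eventually periodic
  coefficients. Indeed, let q be the leading coefficient of an annihilating polynomial. A root y of a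
  polynomial with bounded coefficients becomes bounded after multiplication by the leading coefficient,
  so g = q f is bounded on the unit disc; by Parseval, the squares of its coefficients are summable.
  They take finitely many values up to finitely many exceptions, hence g is a polynomial. So the
  coefficients of f satisfy a linear recurrence, and the pigeonhole principle makes them eventually
  periodic. This is Fatou's argument, with finiteness of the set of values in place of integrality.

  Apply this to the indicator of a letter and to the gaps between its occurrences, the coefficients of
  (1 - X) P, which are bounded because primitivity makes every letter occur with bounded gaps. If the
  indicators of all letters but one are eventually periodic, so is the remaining one, and so is w;
  hence non-periodicity is always witnessed by two letters.
\<close>

subsection \<open>Bounded power series and Parseval\<close>

text \<open>The sum is geometric, and its ratio is an \<open>N\<close>-th root of unity. As
  \<open>n\<close> and \<open>m\<close> both lie below \<open>N\<close>, their difference is a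
  multiple of \<open>N\<close> only if it vanishes, so the ratio is 1 exactly when
  \<open>n = m\<close>.\<close>

lemma cis_orthogonality:
  assumes "n < N" "m < N"
  shows "(\<Sum>k<N. cis (2 * pi * real k / real N) ^ n * cnj (cis (2 * pi * real k / real N) ^ m)) =
    (if n = m then of_nat N else 0)"
proof -
  define \<theta> where "\<theta> = 2 * pi * (real n - real m) / real N"
  have N: "N > 0" using assms by auto
  have "cis (2 * pi * real k / real N) ^ n * cnj (cis (2 * pi * real k / real N) ^ m) = cis \<theta> ^ k" for k
    using N by (simp add: Complex.DeMoivre cis_mult cis_cnj \<theta>_def field_simps)
  then have eq: "(\<Sum>k<N. cis (2 * pi * real k / real N) ^ n * cnj (cis (2 * pi * real k / real N) ^ m)) =
      (\<Sum>k<N. cis \<theta> ^ k)" by simp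
  show ?thesis
  proof (cases "n = m")
    case True
    then show ?thesis unfolding eq by (simp add: \<theta>_def)
  next
    case False
    have "cis \<theta> \<noteq> 1"
    proof
      assume "cis \<theta> = 1"
      then have "cos \<theta> = 1" by (metis cis.simps(1) one_complex.simps(1))
      then obtain i :: int where "\<theta> = of_int i * 2 * pi"
        using cos_one_2pi_int by auto
      then have "2 * pi * (real n - real m) = 2 * pi * (of_int i * real N)"
        using N by (simp add: \<theta>_def divide_eq_eq)
      then have "real n - real m = of_int i * real N" 
        unfolding mult_cancel_left by simp
      then have "real_of_int (int n - int m) = real_of_int (i * int N)"
        by simp
      then have e: "int n - int m = i * int N" by linarith
      then have "i \<noteq> 0" using False by auto
      then have "1 \<le> \<bar>i\<bar>" by linarith
      then have "1 * int N \<le> \<bar>i\<bar> * int N" by (rule mult_right_mono) simp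
      then have "\<bar>i * int N\<bar> \<ge> int N" by (simp add: abs_mult)
      then show False using e assms by linarith
    qed
    moreover have "cis \<theta> ^ N = 1"
    proof -
      have "cis \<theta> ^ N = cis (2 * pi * of_int (int n - int m))"
        using N by (simp add: Complex.DeMoivre \<theta>_def)
      then show ?thesis by (metis cis_multiple_2pi Ints_of_int)
    qed
    ultimately have "(\<Sum>k<N. cis \<theta> ^ k) = 0"
      by (simp add: geometric_sum)
    then show ?thesis unfolding eq using False by simp
  qed
qed

text \<open>Averaging over the \<open>N\<close>-th roots of unity replaces the integral over the
  circle, so only finite sums have to be interchanged.\<close>

lemma discrete_parseval:
  fixes a :: "nat \<Rightarrow> complex"
  shows "(\<Sum>k<N. (cmod (\<Sum>n<N. a n * cis (2 * pi * real k / real N) ^ n))\<^sup>2) =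
    real N * (\<Sum>n<N. (cmod (a n))\<^sup>2)"
proof -
  let ?w = "\<lambda>k. cis (2 * pi * real k / real N)"
  have "complex_of_real (\<Sum>k<N. (cmod (\<Sum>n<N. a n * ?w k ^ n))\<^sup>2) =
      (\<Sum>k<N. (\<Sum>n<N. a n * ?w k ^ n) * cnj (\<Sum>m<N. a m * ?w k ^ m))"
    by (simp only: of_real_sum complex_norm_square)
  also have "\<dots> = (\<Sum>k<N. \<Sum>n<N. \<Sum>m<N. (a n * cnj (a m)) * (?w k ^ n * cnj (?w k ^ m)))"
    by (simp add: sum_product cnj_sum mult_ac)
  also have "\<dots> = (\<Sum>n<N. \<Sum>k<N. \<Sum>m<N. (a n * cnj (a m)) * (?w k ^ n * cnj (?w k ^ m)))"
    by (rule sum.swap)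
  also have "\<dots> = (\<Sum>n<N. \<Sum>m<N. \<Sum>k<N. (a n * cnj (a m)) * (?w k ^ n * cnj (?w k ^ m)))"
    by (intro sum.cong refl sum.swap)
  also have "\<dots> = (\<Sum>n<N. \<Sum>m<N. (a n * cnj (a m)) * (if n = m then of_nat N else 0))"
    by (simp only: sum_distrib_left[symmetric]) (intro sum.cong refl arg_cong2[where f = "(*)"] cis_orthogonality, auto)
  also have "\<dots> = (\<Sum>n<N. of_nat N * (a n * cnj (a n)))"
    by (intro sum.cong refl) (simp add: if_distrib cong: if_cong)
  also have "\<dots> = complex_of_real (real N * (\<Sum>n<N. (cmod (a n))\<^sup>2))"
    by (simp only: sum_distrib_left[symmetric] of_real_mult of_real_sum complex_norm_square of_real_of_nat_eq)
  finally show ?thesis by (simp only: of_real_eq_iff)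
qed

text \<open>On a circle of radius \<open>r < 1\<close> the series is truncated with error at most 1,
  the discrete Parseval identity is applied to the truncation, and \<open>r\<close> then tends to 1.
  The truncation error accounts for the summand 1 in \<open>B + 1\<close>.\<close>

lemma sum_norm_coeffs_square_le:
  fixes g :: "complex fps"
  assumes rad: "fps_conv_radius g \<ge> 1"
    and bnd: "\<And>z. norm z < 1 \<Longrightarrow> norm (eval_fps g z) \<le> B"
  shows "(\<Sum>n<M. (norm (fps_nth g n))\<^sup>2) \<le> (B + 1)\<^sup>2"
proof -
  have main: "(\<Sum>n<M. (norm (fps_nth g n) * r ^ n)\<^sup>2) \<le> (B + 1)\<^sup>2" if r: "0 < r" "r < 1" for r :: real
  proof -
    have "ereal (norm (of_real r :: complex)) < fps_conv_radius g"
      using r rad by (metis abs_of_pos ereal_less(3) less_le_trans norm_of_real)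
    then have sm: "summable (\<lambda>n. norm (fps_nth g n) * r ^ n)"
      using norm_summable_fps[of "of_real r" g] r by (simp add: norm_mult norm_power)
    obtain N0 where N0: "\<And>n. n \<ge> N0 \<Longrightarrow> norm (\<Sum>i. norm (fps_nth g (i + n)) * r ^ (i + n)) < 1"
      using suminf_exist_split[OF zero_less_one sm] by blast
    \<comment> \<open>Large enough for the tail to be below 1 and for the first \<open>M\<close>
      terms to be covered; \<open>Suc\<close> makes it positive, so that the factor \<open>N\<close>
      in Parseval cancels.\<close>
    define N where "N = Suc (max N0 M)"
    have N: "N > 0" "N \<ge> N0" "N \<ge> M" by (auto simp: N_def)
    have trunc: "norm (\<Sum>n<N. fps_nth g n * z ^ n) \<le> B + 1" if z: "norm z = r" for z :: complex
    proof -
      have sz: "summable (\<lambda>n. norm (fps_nth g n * z ^ n))"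
        using sm z by (simp add: norm_mult norm_power)
      have "eval_fps g z = (\<Sum>n. fps_nth g (n + N) * z ^ (n + N)) + (\<Sum>n<N. fps_nth g n * z ^ n)"
        unfolding eval_fps_def by (rule suminf_split_initial_segment) (rule summable_norm_cancel[OF sz])
      moreover have "norm (\<Sum>n. fps_nth g (n + N) * z ^ (n + N)) \<le> (\<Sum>n. norm (fps_nth g (n + N) * z ^ (n + N)))"
        by (rule summable_norm) (use sz in \<open>simp add: summable_iff_shift[of "\<lambda>n. norm (fps_nth g n * z ^ n)"]\<close>)
      moreover have "(\<Sum>n. norm (fps_nth g (n + N) * z ^ (n + N))) \<le> 1"
        using N0[OF N(2)] z by (simp add: norm_mult norm_power)
      moreover have "norm (eval_fps g z) \<le> B" using bnd z r by simp
      ultimately show ?thesis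
        using norm_triangle_ineq4[of "eval_fps g z" "\<Sum>n. fps_nth g (n + N) * z ^ (n + N)"] by simp
    qed
    have "real N * (\<Sum>n<N. (norm (fps_nth g n * of_real r ^ n))\<^sup>2) =
        (\<Sum>k<N. (cmod (\<Sum>n<N. (fps_nth g n * of_real r ^ n) * cis (2 * pi * real k / real N) ^ n))\<^sup>2)"
      by (rule discrete_parseval[symmetric])
    also have "\<dots> \<le> (\<Sum>k<N. (B + 1)\<^sup>2)"
    proof (intro sum_mono power_mono norm_ge_zero)
      fix k
      show "cmod (\<Sum>n<N. (fps_nth g n * of_real r ^ n) * cis (2 * pi * real k / real N) ^ n) \<le> B + 1"
        using trunc[of "of_real r * cis (2 * pi * real k / real N)"] r
        by (simp add: power_mult_distrib norm_mult mult_ac)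
    qed
    also have "\<dots> = real N * (B + 1)\<^sup>2" by simp
    finally have "(\<Sum>n<N. (norm (fps_nth g n) * r ^ n)\<^sup>2) \<le> (B + 1)\<^sup>2"
      using N r by (simp add: norm_mult norm_power)
    moreover have "(\<Sum>n<M. (norm (fps_nth g n) * r ^ n)\<^sup>2) \<le> (\<Sum>n<N. (norm (fps_nth g n) * r ^ n)\<^sup>2)"
      by (rule sum_mono2) (use N in auto)
    ultimately show ?thesis by linarith
  qed
  \<comment> \<open>The bound is uniform in \<open>r\<close>, and \<open>M\<close> is fixed, so the
    finite sum may pass to the limit.\<close>
  have lim: "((\<lambda>r. \<Sum>n<M. (norm (fps_nth g n) * r ^ n)\<^sup>2) \<longlongrightarrow> (\<Sum>n<M. (norm (fps_nth g n) * 1 ^ n)\<^sup>2)) (at_left (1::real))"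
    by (intro tendsto_intros)
  have ev: "\<forall>\<^sub>F r in at_left (1::real). (\<Sum>n<M. (norm (fps_nth g n) * r ^ n)\<^sup>2) \<le> (B + 1)\<^sup>2"
    using eventually_at_left_real[of 0 1] main by (auto elim!: eventually_mono)
  have "(\<Sum>n<M. (norm (fps_nth g n) * 1 ^ n)\<^sup>2) \<le> (B + 1)\<^sup>2"
    by (rule tendsto_upperbound[OF lim ev]) simp
  then show ?thesis by simp
qed

subsection \<open>Algebraic series with finitely many coefficients\<close>

text \<open>Square summability sends the terms to 0, while finitely many nonzero values keep a
  positive distance from 0. The threshold \<open>D\<close> leaves room for exceptional early
  terms.\<close>

lemma eventually_zero_if_square_sums_bounded:
  fixes g :: "nat \<Rightarrow> complex"
  assumes fin: "finite (g ` {D..})" and bnd: "\<And>M. (\<Sum>n<M. (norm (g n))\<^sup>2) \<le> B"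
  shows "\<exists>N. \<forall>n\<ge>N. g n = 0"
proof -
  have "summable (\<lambda>n. (norm (g n))\<^sup>2)"
    by (rule summableI_nonneg_bounded) (use bnd in auto)
  then have "(\<lambda>n. (norm (g n))\<^sup>2) \<longlonglongrightarrow> 0" by (rule summable_LIMSEQ_zero)
  then have "(\<lambda>n. sqrt ((norm (g n))\<^sup>2)) \<longlonglongrightarrow> sqrt 0" by (rule tendsto_real_sqrt)
  then have "(\<lambda>n. norm (g n)) \<longlonglongrightarrow> 0" by simp
  then have "g \<longlonglongrightarrow> 0" by (rule tendsto_norm_zero_cancel)
  moreover have "open (- (g ` {D..} - {0}))"
    by (intro open_Compl finite_imp_closed) (use fin in simp)
  ultimately have "\<forall>\<^sub>F n in sequentially. g n \<in> - (g ` {D..} - {0})"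
    by (rule topological_tendstoD) auto
  then obtain N where "\<And>n. n \<ge> N \<Longrightarrow> g n \<in> - (g ` {D..} - {0})"
    by (auto simp: eventually_sequentially)
  then have "\<forall>n\<ge>max N D. g n = 0" by auto
  then show ?thesis by blast
qed

text \<open>Meant for the coefficients of a polynomial multiple of a series. For
  \<open>n < i\<close> the truncated difference yields \<open>c 0\<close>, which does no harm to
  finiteness.\<close>

lemma finite_range_sum_shifts:
  fixes c :: "nat \<Rightarrow> complex"
  assumes "finite (range c)" "finite I"
  shows "finite (range (\<lambda>n. \<Sum>i\<in>I. q i * c (n - i)))"
  using assms(2)
proof (induction I rule: finite_induct)
  case empty
  then show ?case by simp
next
  case (insert i I)
  have "range (\<lambda>n. \<Sum>i\<in>insert i I. q i * c (n - i)) \<subseteq>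
      (\<lambda>(x, y). q i * x + y) ` (range c \<times> range (\<lambda>n. \<Sum>i\<in>I. q i * c (n - i)))"
    using insert by force
  then show ?case
    by (rule finite_subset) (use insert assms in auto)
qed

text \<open>Windows of length \<open>L\<close> are the states of a deterministic system with
  finitely many states: once a state recurs beyond \<open>M\<close>, everything after it
  repeats.\<close>

lemma finite_state_imp_eventually_periodic:
  fixes c :: "nat \<Rightarrow> 'b"
  assumes fin: "finite (range c)"
    and det: "\<And>m m'. M \<le> m \<Longrightarrow> M \<le> m' \<Longrightarrow> (\<forall>j<L. c (m + j) = c (m' + j)) \<Longrightarrow> c (m + L) = c (m' + L)"
  shows "eventually_periodic c"
proof -
  define W where "W m = map (\<lambda>j. c (m + j)) [0..<L]" for m
  have W_eq_iff: "W m = W m' \<longleftrightarrow> (\<forall>j<L. c (m + j) = c (m' + j))" for m m'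
    by (auto simp: W_def)
  have "range W \<subseteq> {xs. set xs \<subseteq> range c \<and> length xs = L}"
    by (auto simp: W_def)
  then have "finite (W ` {M..})"
    using finite_subset[OF _ finite_lists_length_eq[OF fin, of L]] by (metis finite_subset image_mono subset_UNIV)
  \<comment> \<open>Some state occurs infinitely often, hence again at a position strictly after
    \<open>m\<close>.\<close>
  then obtain m where m: "m \<ge> M" and inf: "infinite {m' \<in> {M..}. W m' = W m}"
    using pigeonhole_infinite[of "{M..}" W] infinite_Ici by auto
  then obtain m' where m': "m' > m" "W m' = W m"
    by (metis (mono_tags, lifting) infinite_nat_iff_unbounded mem_Collect_eq)
  have step: "W (m' + k) = W (m + k)" for k
  proof (induction k)
    case 0
    then show ?case using m' by simp
  next
    case (Suc k)
    have eq: "\<forall>j<L. c (m' + k + j) = c (m + k + j)"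
      using Suc W_eq_iff by blast
    have "c (m' + k + L) = c (m + k + L)"
      by (rule det) (use m m' eq in auto)
    with eq have "\<forall>j<Suc L. c (m' + k + j) = c (m + k + j)"
      by (auto simp: less_Suc_eq)
    then have "c (m' + k + Suc j) = c (m + k + Suc j)" if "j < L" for j
      using that by blast
    then show ?case
      unfolding W_eq_iff by simp
  qed
  have "c (m' + k + L) = c (m + k + L)" for k
    by (rule det) (use m m' step W_eq_iff in auto)
  then have "c (n + (m' - m)) = c n" if "n \<ge> m + L" for n
    using that m' spec[of "\<lambda>k. c (m' + k + L) = c (m + k + L)" "n - m - L"] by (simp add: algebra_simps)
  moreover have "m' - m \<ge> 1" using m' by simp
  ultimately show ?thesis
    unfolding eventually_periodic_def by blast
qed

lemma linear_recurrence_imp_eventually_periodic: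
  fixes c :: "nat \<Rightarrow> complex"
  assumes fin: "finite (range c)" and "q \<noteq> 0"
    and rec: "\<And>n. n \<ge> N \<Longrightarrow> (\<Sum>i\<le>degree q. coeff q i * c (n - i)) = 0"
  shows "eventually_periodic c"
proof -
  define D where "D = degree q"
  \<comment> \<open>The constant coefficient of \<open>q\<close> may vanish. The lowest nonzero
    coefficient belongs to the term of largest index in the recurrence, and that is the term to
    solve for.\<close>
  define l where "l = (LEAST i. coeff q i \<noteq> 0)"
  have "coeff q D \<noteq> 0" using \<open>q \<noteq> 0\<close> by (simp add: D_def)
  then have l: "coeff q l \<noteq> 0" "l \<le> D"
    unfolding l_def by (rule LeastI, rule Least_le)
  have below: "coeff q i = 0" if "i < l" for i
    using not_less_Least that unfolding l_def by blast
  define L where "L = D - l"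
  \<comment> \<open>The recurrence is used at \<open>n = m + D\<close>, where no difference
    \<open>n - i\<close> is truncated.\<close>
  have solve: "coeff q l * c (m + L) = - (\<Sum>j<L. coeff q (D - j) * c (m + j))" if "m \<ge> N" for m
  proof -
    have "0 = (\<Sum>i\<le>D. coeff q i * c (m + D - i))"
      using rec[of "m + D"] that by (simp add: D_def)
    also have "\<dots> = (\<Sum>j\<le>D. coeff q (D - j) * c (m + j))"
      by (rule sum.reindex_bij_witness[of _ "\<lambda>j. D - j" "\<lambda>j. D - j"]) auto
    also have "\<dots> = (\<Sum>j\<le>L. coeff q (D - j) * c (m + j))"
      by (rule sum.mono_neutral_right) (auto simp: L_def intro!: below)
    also have "\<dots> = (\<Sum>j<L. coeff q (D - j) * c (m + j)) + coeff q l * c (m + L)"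
      using l by (simp add: L_def flip: lessThan_Suc_atMost)
    finally show ?thesis by (simp add: eq_neg_iff_add_eq_0 add.commute)
  qed
  show ?thesis
  proof (rule finite_state_imp_eventually_periodic[OF fin])
    fix m m' assume "N \<le> m" "N \<le> m'" and eq: "\<forall>j<L. c (m + j) = c (m' + j)"
    then have "coeff q l * c (m + L) = coeff q l * c (m' + L)"
      by (simp add: solve)
    then show "c (m + L) = c (m' + L)" using l by simp
  qed
qed

section \<open>Boundedness on the unit disc\<close>

lemma fps_conv_radius_ge_1_if_finite_range:
  fixes f :: "complex fps"
  assumes "finite (range (fps_nth f))"
  shows "fps_conv_radius f \<ge> 1"
  unfolding fps_conv_radius_def
proof (rule conv_radius_geI_ex')
  fix r :: real assume r: "0 < r" "ereal r < 1"
  obtain B where B: "\<And>n. norm (fps_nth f n) \<le> B"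
    using finite_imp_bounded[OF assms] by (auto simp: bounded_iff)
  have "summable (\<lambda>n. B * r ^ n)"
    using r by (intro summable_mult summable_geometric) auto
  then show "summable (\<lambda>n. fps_nth f n * complex_of_real r ^ n)"
    by (rule summable_comparison_test'[where N = 0])
      (use B r in \<open>simp add: norm_mult norm_power mult_right_mono\<close>)
qed

lemma poly_bounded_on_disc:
  fixes p :: "complex poly"
  shows "\<exists>K. \<forall>z. norm z \<le> 1 \<longrightarrow> norm (poly p z) \<le> K"
proof -
  have "compact (poly p ` cball 0 1)"
    by (intro compact_continuous_image continuous_intros) auto
  then have "bounded (poly p ` cball 0 1)" by (rule compact_imp_bounded)
  then show ?thesis unfolding bounded_iff by (metis image_eqI mem_cball_0)
qed

text \<open>Near a zero of the leading coefficient the root may blow up, but this product cannot: if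
  \<open>norm y > 1\<close>, isolate the leading term and divide by \<open>y ^ (d - 1)\<close>;
  every remaining power of \<open>y\<close> then has norm at most 1.\<close>

lemma norm_lead_coeff_mult_root_le:
  fixes y :: complex
  assumes "\<And>i. i \<le> d \<Longrightarrow> norm (a i) \<le> K" and root: "(\<Sum>i\<le>d. a i * y ^ i) = 0"
  shows "norm (a d * y) \<le> (real d + 1) * K"
proof -
  have K: "0 \<le> K" using assms(1)[of d] norm_ge_zero order_trans by blast
  consider "norm y \<le> 1" | "d = 0" | e where "norm y > 1" "d = Suc e"
    by (metis not_le not0_implies_Suc)
  then show ?thesis
  proof cases
    case 1
    then have "norm (a d * y) \<le> K * 1"
      unfolding norm_mult using assms(1)[of d] K by (intro mult_mono) auto
    also have "\<dots> \<le> (real d + 1) * K" using K by (simp add: algebra_simps)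
    finally show ?thesis .
  next
    \<comment> \<open>With \<open>d = 0\<close> the relation reads \<open>a 0 = 0\<close>, so the
      product vanishes.\<close>
    case 2
    then show ?thesis using root K by simp
  next
    case 3
    note y = 3(1) and e = 3(2)
    have "a d * y ^ d = - (\<Sum>i<d. a i * y ^ i)"
      using root by (simp add: eq_neg_iff_add_eq_0 add.commute flip: lessThan_Suc_atMost)
    then have "norm (a d * y ^ d) = norm (\<Sum>i<d. a i * y ^ i)"
      by (simp only: norm_minus_cancel)
    then have "norm (a d * y) * norm y ^ e = norm (\<Sum>i<d. a i * y ^ i)"
      by (simp add: e norm_mult norm_power mult.assoc)
    also have "\<dots> \<le> (\<Sum>i<d. K * norm y ^ e)"
    proof (rule sum_norm_le)
      fix i assume "i \<in> {..<d}"
      then show "norm (a i * y ^ i) \<le> K * norm y ^ e"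
        unfolding norm_mult norm_power
        using assms(1)[of i] y e K by (intro mult_mono power_increasing) auto
    qed
    also have "\<dots> = (real d * K) * norm y ^ e" by simp
    finally have "norm (a d * y) \<le> real d * K"
      by (rule mult_right_le_imp_le) (use y in \<open>intro zero_less_power, linarith\<close>)
    also have "\<dots> \<le> (real d + 1) * K" using K by (simp add: algebra_simps)
    finally show ?thesis .
  qed
qed

text \<open>Evaluation turns a formal relation into a pointwise one inside the disc of convergence.
  The claim on the radius is proved along with it, because evaluating a sum requires both summands
  to converge at \<open>z\<close>.\<close>

lemma eval_fps_poly_relation:
  fixes f :: "complex fps"
  assumes "norm z < fps_conv_radius f"
  shows "eval_fps (\<Sum>i\<in>I. fps_of_poly (A i) * f ^ i) z = (\<Sum>i\<in>I. poly (A i) z * eval_fps f z ^ i)"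
    and "norm z < fps_conv_radius (\<Sum>i\<in>I. fps_of_poly (A i) * f ^ i)"
proof -
  have rad_term: "norm z < fps_conv_radius (fps_of_poly (A i) * f ^ i)" for i
  proof -
    have "fps_conv_radius f \<le> fps_conv_radius (fps_of_poly (A i) * f ^ i)"
      using fps_conv_radius_mult[of "fps_of_poly (A i)" "f ^ i"] fps_conv_radius_power[of f i]
      by (auto simp: min_def split: if_splits)
    then show ?thesis using assms by (rule less_le_trans[rotated])
  qed
  have term_eval: "eval_fps (fps_of_poly (A i) * f ^ i) z = poly (A i) z * eval_fps f z ^ i" for i
    using assms fps_conv_radius_power[of f i]
    by (subst eval_fps_mult) (auto simp: eval_fps_power intro: less_le_trans)
  have "eval_fps (\<Sum>i\<in>I. fps_of_poly (A i) * f ^ i) z = (\<Sum>i\<in>I. poly (A i) z * eval_fps f z ^ i) \<and>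
      norm z < fps_conv_radius (\<Sum>i\<in>I. fps_of_poly (A i) * f ^ i)"
  proof (induction I rule: infinite_finite_induct)
    case (insert i I)
    have "norm z < min (fps_conv_radius (fps_of_poly (A i) * f ^ i)) 
        (fps_conv_radius (\<Sum>i\<in>I. fps_of_poly (A i) * f ^ i))"
      using rad_term insert by simp
    also have "\<dots> \<le> fps_conv_radius (fps_of_poly (A i) * f ^ i + (\<Sum>i\<in>I. fps_of_poly (A i) * f ^ i))"
      by (rule fps_conv_radius_add)
    finally show ?case
      using insert rad_term[of i] by (simp add: eval_fps_add term_eval)
  qed auto
  then show "eval_fps (\<Sum>i\<in>I. fps_of_poly (A i) * f ^ i) z = (\<Sum>i\<in>I. poly (A i) z * eval_fps f z ^ i)"
    "norm z < fps_conv_radius (\<Sum>i\<in>I. fps_of_poly (A i) * f ^ i)" by blast+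
qed

text \<open>The argument needs no arithmetic of the coefficients, so they may be arbitrary complex
  polynomials. That \<open>A d\<close> is nonzero makes the final recurrence a nontrivial
  one.\<close>

theorem algebraic_finite_range_imp_eventually_periodic:
  fixes f :: "complex fps" and A :: "nat \<Rightarrow> complex poly"
  assumes fin: "finite (range (fps_nth f))" and "A d \<noteq> 0"
    and rel: "(\<Sum>i\<le>d. fps_of_poly (A i) * f ^ i) = 0"
  shows "eventually_periodic (fps_nth f)"
proof -
  define g where "g = fps_of_poly (A d) * f"
  have rad: "fps_conv_radius f \<ge> 1"
    by (rule fps_conv_radius_ge_1_if_finite_range[OF fin])
  have "fps_conv_radius g \<ge> 1"
    using fps_conv_radius_mult[of "fps_of_poly (A d)" f] rad by (simp add: g_def)
  moreover
  obtain K where K: "\<And>i z. norm z \<le> 1 \<Longrightarrow> norm (poly (A i) z) \<le> K i"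
    using choice[OF allI, of "\<lambda>i K. \<forall>z. norm z \<le> 1 \<longrightarrow> norm (poly (A i) z) \<le> K"]
      poly_bounded_on_disc by blast
  \<comment> \<open>The sum of absolute values dominates each single \<open>K i\<close>, giving one
    bound for all coefficients.\<close>
  define B where "B = (real d + 1) * (\<Sum>i\<le>d. \<bar>K i\<bar>)"
  have "norm (eval_fps g z) \<le> B" if z: "norm z < 1" for z
  proof -
    have zr: "norm z < fps_conv_radius f"
      using z rad by (meson ereal_less(3) less_le_trans)
    have "norm (poly (A i) z) \<le> (\<Sum>i\<le>d. \<bar>K i\<bar>)" if "i \<le> d" for i
      using K[of z i] z member_le_sum[of i "{..d}" "\<lambda>i. \<bar>K i\<bar>"] that by force
    moreover have "(\<Sum>i\<le>d. poly (A i) z * eval_fps f z ^ i) = 0"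
      using eval_fps_poly_relation(1)[OF zr, of A "{..d}"] rel by simp
    ultimately have "norm (poly (A d) z * eval_fps f z) \<le> B"
      unfolding B_def by (rule norm_lead_coeff_mult_root_le)
    then show ?thesis
      using zr by (simp add: g_def eval_fps_mult)
  qed
  ultimately have sq: "(\<Sum>n<M. (norm (fps_nth g n))\<^sup>2) \<le> (B + 1)\<^sup>2" for M
    by (rule sum_norm_coeffs_square_le)
  \<comment> \<open>From the degree of \<open>A d\<close> on, the convolution has a fixed set of
    terms and no truncated index. Earlier coefficients are the finitely many exceptions.\<close>
  have g_nth: "fps_nth g n = (\<Sum>i\<le>degree (A d). coeff (A d) i * fps_nth f (n - i))"
    if "n \<ge> degree (A d)" for n
    unfolding g_def fps_mult_nth using that
    by (intro sum.mono_neutral_cong_right) (auto simp: coeff_eq_0)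
  have "finite (fps_nth g ` {degree (A d)..})"
    by (rule finite_subset[OF _ finite_range_sum_shifts[OF fin, of "{..degree (A d)}" "coeff (A d)"]])
      (auto simp: g_nth)
  from eventually_zero_if_square_sums_bounded[OF this sq]
  obtain N where "\<And>n. n \<ge> N \<Longrightarrow> fps_nth g n = 0" by blast
  then show ?thesis
    by (intro linear_recurrence_imp_eventually_periodic[OF fin \<open>A d \<noteq> 0\<close>, of "max N (degree (A d))"])
      (simp add: g_nth[symmetric])
qed

subsection \<open>Eventual periodicity\<close>

text \<open>Transfers periodicity between truth values, naturals and complex coefficients.\<close>

lemma eventually_periodic_comp_inj_on:
  assumes "inj_on h (range c)"
  shows "eventually_periodic (\<lambda>n. h (c n)) \<longleftrightarrow> eventually_periodic c"
  unfolding eventually_periodic_def using assms by (simp add: inj_on_eq_iff)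

lemma eventually_periodic_shift:
  "eventually_periodic (\<lambda>n. c (n + k)) \<longleftrightarrow> eventually_periodic c"
proof
  assume "eventually_periodic (\<lambda>n. c (n + k))"
  then obtain N d where d: "d \<ge> 1" and per: "\<And>n. n \<ge> N \<Longrightarrow> c (n + d + k) = c (n + k)"
    by (auto simp: eventually_periodic_def)
  have "c (n + d) = c n" if "n \<ge> N + k" for n
    using per[of "n - k"] that by (simp add: algebra_simps)
  with d show "eventually_periodic c" by (auto simp: eventually_periodic_def)
next
  assume "eventually_periodic c"
  then obtain N d where d: "d \<ge> 1" and per: "\<And>n. n \<ge> N \<Longrightarrow> c (n + d) = c n"
    by (auto simp: eventually_periodic_def)
  have "c (n + d + k) = c (n + k)" if "n \<ge> N" for n
    using per[of "n + k"] that by (simp add: algebra_simps)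
  with d show "eventually_periodic (\<lambda>n. c (n + k))" by (auto simp: eventually_periodic_def)
qed

lemma periodic_multiple:
  fixes c :: "nat \<Rightarrow> 'b"
  assumes "\<And>n. n \<ge> N \<Longrightarrow> c (n + d) = c n" "n \<ge> N"
  shows "c (n + k * d) = c n"
proof (induction k)
  case (Suc k)
  have "c (n + k * d + d) = c (n + k * d)"
    by (rule assms(1)) (use assms(2) in simp)
  with Suc show ?case by (simp add: ac_simps)
qed simp

text \<open>The product of the periods serves as a common period, beyond the largest
  threshold.\<close>

lemma eventually_periodic_common:
  fixes F :: "'i \<Rightarrow> nat \<Rightarrow> 'b"
  assumes "finite I" "\<And>i. i \<in> I \<Longrightarrow> eventually_periodic (F i)"
  shows "\<exists>N d. d \<ge> 1 \<and> (\<forall>i\<in>I. \<forall>n\<ge>N. F i (n + d) = F i n)"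
  using assms
proof (induction I rule: finite_induct)
  case empty
  then show ?case by auto
next
  case (insert i I)
  then obtain N d N' d' where
    d: "d \<ge> 1" and per: "\<And>j n. j \<in> I \<Longrightarrow> n \<ge> N \<Longrightarrow> F j (n + d) = F j n" and
    d': "d' \<ge> 1" and per': "\<And>n. n \<ge> N' \<Longrightarrow> F i (n + d') = F i n"
    by (auto simp: eventually_periodic_def) metis
  have "F j (n + d * d') = F j n" if "j \<in> insert i I" "n \<ge> max N N'" for j n
    using that periodic_multiple[of N "F j" d n d'] periodic_multiple[of N' "F i" d' n d] per per'
    by (auto simp: mult.commute)
  moreover have "d * d' \<ge> 1" using d d' by simp
  ultimately show ?case by blast
qed

text \<open>One letter \<open>a\<close> can be exempted: it stands exactly where none of the others
  does.\<close>

lemma eventually_periodic_if_indicators: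
  fixes w :: "nat \<Rightarrow> 'a::finite"
  assumes "\<And>b. b \<noteq> a \<Longrightarrow> eventually_periodic (\<lambda>n. w n = b)"
  shows "eventually_periodic w"
proof -
  obtain N d where d: "d \<ge> 1"
    and per: "\<forall>b\<in>UNIV - {a}. \<forall>n\<ge>N. (w (n + d) = b) = (w n = b)"
    using eventually_periodic_common[of "UNIV - {a}" "\<lambda>b n. w n = b"] assms by auto
  have "w (n + d) = w n" if "n \<ge> N" for n
    using per that by (metis DiffI UNIV_I empty_iff insert_iff)
  with d show ?thesis by (auto simp: eventually_periodic_def)
qed

text \<open>Both directions go through \<open>shift\<close>: advancing by \<open>r\<close> elements
  of \<open>E\<close> adds the constant \<open>d\<close>. Here \<open>d\<close> is a period of
  membership, \<open>r\<close> a period of the gaps, and \<open>r\<close> counts the elements of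
  \<open>E\<close> in one period of length \<open>d\<close>.\<close>

lemma eventually_periodic_enumerate_diff_iff:
  fixes E :: "nat set"
  assumes inf: "infinite E"
  shows "eventually_periodic (\<lambda>n. enumerate E (Suc n) - enumerate E n) \<longleftrightarrow> eventually_periodic (\<lambda>n. n \<in> E)"
proof
  let ?p = "enumerate E"
  assume "eventually_periodic (\<lambda>n. ?p (Suc n) - ?p n)"
  then obtain M r where r: "r \<ge> 1"
    and per: "\<And>n. n \<ge> M \<Longrightarrow> ?p (Suc (n + r)) - ?p (n + r) = ?p (Suc n) - ?p n"
    by (auto simp: eventually_periodic_def)
  define d where "d = ?p (M + r) - ?p M"
  have "?p M < ?p (M + r)" using inf r by simp
  then have d: "d \<ge> 1" "?p (M + r) = ?p M + d" by (auto simp: d_def)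
  have shift: "?p (n + r) = ?p n + d" if "n \<ge> M" for n
    using that
  proof (induction n rule: dec_induct)
    case (step n)
    then show ?case
      using per[of n] enumerate_step[OF inf, of n] enumerate_step[OF inf, of "n + r"] by simp
  qed (use d in simp)
  have "(m + d \<in> E) = (m \<in> E)" if m: "m \<ge> ?p M" for m
  proof
    assume "m \<in> E"
    then obtain n where n: "m = ?p n" using enumerate_Ex inf by metis
    then have "n \<ge> M" using m inf by simp
    then show "m + d \<in> E" using shift n enumerate_in_set[OF inf] by metis
  next
    assume "m + d \<in> E"
    then obtain k where k: "m + d = ?p k" using enumerate_Ex inf by metis
    then have "?p (M + r) \<le> ?p k" using m d by simp
    then have "k \<ge> M + r" using inf by simp
    then have "?p k = ?p (k - r) + d" using shift[of "k - r"] by simp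
    then show "m \<in> E" using k enumerate_in_set[OF inf] by simp
  qed
  with d(1) show "eventually_periodic (\<lambda>n. n \<in> E)"
    unfolding eventually_periodic_def by blast
next
  let ?p = "enumerate E"
  assume "eventually_periodic (\<lambda>n. n \<in> E)"
  then obtain N d where d: "d \<ge> 1" and per: "\<And>m. m \<ge> N \<Longrightarrow> (m + d \<in> E) = (m \<in> E)"
    by (auto simp: eventually_periodic_def)
  have N: "?p n \<ge> N" if "n \<ge> N" for n
    using le_enumerate[OF inf, of n] that by simp
  \<comment> \<open>Translating one element by \<open>d\<close> lands on an element again; the index
    difference is the period \<open>r\<close>.\<close>
  have "?p N + d \<in> E" using per[OF N] enumerate_in_set[OF inf] by simp
  then obtain k where k: "?p N + d = ?p k" using enumerate_Ex inf by metis
  then have "?p N < ?p k" using d by simp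
  then have "N < k" using inf by simp
  then obtain r where r: "k = N + r" "r \<ge> 1"
    by (metis Suc_leI add_diff_inverse_nat less_imp_le_nat linorder_not_less zero_less_diff One_nat_def)
  have shift: "?p (n + r) = ?p n + d" if "n \<ge> N" for n
    using that
  proof (induction n rule: dec_induct)
    case base
    then show ?case using k r by simp
  next
    case (step n)
    have "?p (Suc n + r) = (LEAST s. s \<in> E \<and> ?p n + d < s)"
      using enumerate_Suc''[OF inf, of "n + r"] step by simp
    also have "\<dots> = ?p (Suc n) + d"
    proof (rule Least_equality)
      show "?p (Suc n) + d \<in> E \<and> ?p n + d < ?p (Suc n) + d"
        using per[OF N] step enumerate_in_set[OF inf] enumerate_step[OF inf] by simp
    next
      \<comment> \<open>Any competitor can be moved back by \<open>d\<close>, staying in the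
        periodic range, and then lies after \<open>?p n\<close>.\<close>
      fix s assume s: "s \<in> E \<and> ?p n + d < s"
      then have "s - d \<ge> N" "s = s - d + d" using N[of n] step by auto
      then have "s - d \<in> E" using per s by metis
      moreover have "?p n < s - d" using s by linarith
      ultimately have "?p (Suc n) \<le> s - d"
        unfolding enumerate_Suc''[OF inf] by (intro Least_le) simp
      then show "?p (Suc n) + d \<le> s" using s by linarith
    qed
    finally show ?case .
  qed
  have "?p (Suc (n + r)) - ?p (n + r) = ?p (Suc n) - ?p n" if "n \<ge> N" for n
    using shift[of n] shift[of "Suc n"] that by simp
  with r(2) show "eventually_periodic (\<lambda>n. ?p (Suc n) - ?p n)"
    unfolding eventually_periodic_def by blast
qed

subsection \<open>Primitive fixed points have bounded gaps\<close>

definition subst_word :: "('a \<Rightarrow> 'a list) \<Rightarrow> 'a list \<Rightarrow> 'a list" where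
  "subst_word \<sigma> u = concat (map \<sigma> u)"

lemma subst_word_append: "subst_word \<sigma> (u @ v) = subst_word \<sigma> u @ subst_word \<sigma> v"
  by (simp add: subst_word_def)

lemma subst_word_funpow_append:
  "(subst_word \<sigma> ^^ n) (u @ v) = (subst_word \<sigma> ^^ n) u @ (subst_word \<sigma> ^^ n) v"
  by (induction n) (simp_all add: subst_word_append)

lemma subst_word_funpow_Nil: "(subst_word \<sigma> ^^ n) [] = []"
  by (induction n) (simp_all add: subst_word_def)

lemma length_subst_word_ge:
  assumes "is_substitution \<sigma>"
  shows "length u \<le> length (subst_word \<sigma> u)"
proof (induction u)
  case (Cons a u)
  have "length (\<sigma> a) \<ge> 1"
    using assms by (simp add: is_substitution_def Suc_leI)
  with Cons show ?case by (simp add: subst_word_def)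
qed (simp add: subst_word_def)

text \<open>Abelianisation: letter counts form a row vector, on which the substitution acts through
  its matrix from the right.\<close>

lemma count_list_subst_word:
  fixes u :: "'a::finite list"
  shows "count_list (subst_word \<sigma> u) b = (\<Sum>l\<in>UNIV. count_list u l * subst_matrix \<sigma> l b)"
proof (induction u)
  case (Cons a u)
  have "(\<Sum>l\<in>UNIV. count_list (a # u) l * subst_matrix \<sigma> l b) =
      (\<Sum>l\<in>UNIV. (if l = a then subst_matrix \<sigma> l b else 0) + count_list u l * subst_matrix \<sigma> l b)"
    by (intro sum.cong) auto
  also have "\<dots> = subst_matrix \<sigma> a b + (\<Sum>l\<in>UNIV. count_list u l * subst_matrix \<sigma> l b)"
    by (simp add: sum.distrib)
  finally show ?case using Cons by (simp add: subst_word_def subst_matrix_def)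
qed (simp add: subst_word_def)

text \<open>One application is peeled off on the inside, to match the recursion of
  \<open>mat_pow\<close>; the induction therefore needs arbitrary \<open>u\<close>.\<close>

lemma count_list_subst_word_funpow:
  fixes u :: "'a::finite list"
  shows "count_list ((subst_word \<sigma> ^^ n) u) b = (\<Sum>l\<in>UNIV. count_list u l * mat_pow (subst_matrix \<sigma>) n l b)"
proof (induction n arbitrary: u)
  case 0
  show ?case by (simp add: if_distrib cong: if_cong)
next
  case (Suc n)
  have "count_list ((subst_word \<sigma> ^^ Suc n) u) b =
      (\<Sum>l\<in>UNIV. (\<Sum>k\<in>UNIV. count_list u k * subst_matrix \<sigma> k l) * mat_pow (subst_matrix \<sigma>) n l b)"
    by (simp add: funpow_Suc_right Suc count_list_subst_word del: funpow.simps)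
  also have "\<dots> = (\<Sum>l\<in>UNIV. \<Sum>k\<in>UNIV. count_list u k * (subst_matrix \<sigma> k l * mat_pow (subst_matrix \<sigma>) n l b))"
    by (simp add: sum_distrib_right mult.assoc)
  also have "\<dots> = (\<Sum>k\<in>UNIV. \<Sum>l\<in>UNIV. count_list u k * (subst_matrix \<sigma> k l * mat_pow (subst_matrix \<sigma>) n l b))"
    by (rule sum.swap)
  also have "\<dots> = (\<Sum>k\<in>UNIV. count_list u k * mat_pow (subst_matrix \<sigma>) (Suc n) k b)"
    by (simp add: mat_mult_def sum_distrib_left)
  finally show ?case .
qed

text \<open>Row \<open>a\<close> of the \<open>n\<close>-th matrix power counts the letters in the
  \<open>n\<close>-th iterate of \<open>a\<close>, so a positive row means that every letter
  occurs.\<close>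

lemma primitive_subst_imp_all_letters:
  fixes \<sigma> :: "'a::finite \<Rightarrow> 'a list"
  assumes "primitive_subst \<sigma>"
  shows "\<exists>n. \<forall>a b. b \<in> set ((subst_word \<sigma> ^^ n) [a])"
proof -
  obtain n where n: "\<And>i j. mat_pow (subst_matrix \<sigma>) n i j > 0"
    using assms by (auto simp: primitive_subst_def)
  have "count_list ((subst_word \<sigma> ^^ n) [a]) b = (\<Sum>l\<in>UNIV. if l = a then mat_pow (subst_matrix \<sigma>) n l b else 0)" for a b
    unfolding count_list_subst_word_funpow by (intro sum.cong) auto
  then have "count_list ((subst_word \<sigma> ^^ n) [a]) b \<noteq> 0" for a b
    using n[of a b] by simp
  then show ?thesis by (metis count_notin)
qed

section \<open>Prefixes of a fixed point and its block decomposition\<close>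

definition prefix_of_word :: "(nat \<Rightarrow> 'a) \<Rightarrow> nat \<Rightarrow> 'a list" where
  "prefix_of_word w m = map w [0..<m]"

lemma nth_prefix_of_word: "i < m \<Longrightarrow> prefix_of_word w m ! i = w i"
  by (simp add: prefix_of_word_def)

lemma subst_word_prefix_append:
  assumes "m \<le> m'"
  shows "\<exists>v. subst_word \<sigma> (prefix_of_word w m') = subst_word \<sigma> (prefix_of_word w m) @ v"
proof -
  have "prefix_of_word w m' = prefix_of_word w m @ map w [m..<m']"
    using assms unfolding prefix_of_word_def by (metis le_add_diff_inverse map_append upt_add_eq_append zero_le)
  then show ?thesis by (auto simp: subst_word_append)
qed

text \<open>\<open>subst_inf\<close> reads letter \<open>i\<close> off the image of the prefix of
  length \<open>i + 1\<close>. Of this image and that of the prefix of length \<open>m\<close>, one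
  is a prefix of the other, so they agree at \<open>i\<close>.\<close>

lemma fixed_point_subst_word_prefix:
  assumes "is_substitution \<sigma>" "subst_inf \<sigma> w = w"
  shows "subst_word \<sigma> (prefix_of_word w m) = prefix_of_word w (length (subst_word \<sigma> (prefix_of_word w m)))"
proof (rule nth_equalityI)
  fix i assume i: "i < length (subst_word \<sigma> (prefix_of_word w m))"
  have len: "i < length (subst_word \<sigma> (prefix_of_word w (Suc i)))"
    using length_subst_word_ge[OF assms(1), of "prefix_of_word w (Suc i)"] by (simp add: prefix_of_word_def)
  have wi: "w i = subst_word \<sigma> (prefix_of_word w (Suc i)) ! i"
    using fun_cong[OF assms(2), of i] by (simp add: subst_inf_def subst_word_def prefix_of_word_def)
  have "subst_word \<sigma> (prefix_of_word w m) ! i = subst_word \<sigma> (prefix_of_word w (Suc i)) ! i"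
  proof (cases "m \<le> Suc i")
    case True
    then show ?thesis using subst_word_prefix_append[OF True, of \<sigma> w] i by (auto simp: nth_append)
  next
    case False
    then have "Suc i \<le> m" by simp
    then show ?thesis using subst_word_prefix_append[of "Suc i" m \<sigma> w] len by (auto simp: nth_append)
  qed
  then show "subst_word \<sigma> (prefix_of_word w m) ! i =
      prefix_of_word w (length (subst_word \<sigma> (prefix_of_word w m))) ! i"
    unfolding nth_prefix_of_word[OF i] wi .
qed (simp add: prefix_of_word_def)

lemma fixed_point_subst_word_funpow_prefix:
  assumes "is_substitution \<sigma>" "subst_inf \<sigma> w = w"
  shows "(subst_word \<sigma> ^^ n) (prefix_of_word w m) =
    prefix_of_word w (length ((subst_word \<sigma> ^^ n) (prefix_of_word w m)))"
proof (induction n)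
  case 0
  show ?case by (simp add: prefix_of_word_def)
next
  case (Suc n)
  then show ?case
    using fixed_point_subst_word_prefix[OF assms] by (metis comp_apply funpow.simps(2))
qed

text \<open>The word is the concatenation of the blocks \<open>\<tau> (w 0)\<close>,
  \<open>\<tau> (w 1)\<close> and so on. Each contains all letters and has length at most
  \<open>L\<close>, so every window of length \<open>2 * L\<close> contains a full block.\<close>

lemma primitive_fixed_point_bounded_gaps:
  fixes \<sigma> :: "'a::finite \<Rightarrow> 'a list"
  assumes "is_substitution \<sigma>" "primitive_subst \<sigma>" "subst_inf \<sigma> w = w"
  shows "\<exists>G. \<forall>a m. \<exists>k\<ge>m. k < m + G \<and> w k = a"
proof -
  obtain n where n: "\<And>a b. b \<in> set ((subst_word \<sigma> ^^ n) [a])"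
    using primitive_subst_imp_all_letters[OF assms(2)] by blast
  define \<tau> where "\<tau> a = (subst_word \<sigma> ^^ n) [a]" for a
  \<comment> \<open>The position at which block \<open>m\<close> starts.\<close>
  define t where "t m = length ((subst_word \<sigma> ^^ n) (prefix_of_word w m))" for m
  define L where "L = (\<Sum>a\<in>UNIV. length (\<tau> a))"
  have \<tau>_le: "length (\<tau> a) \<le> L" for a
    unfolding L_def by (rule member_le_sum) auto
  have \<tau>_pos: "length (\<tau> a) > 0" for a
    using n[of a a] by (auto simp: \<tau>_def)
  have split: "(subst_word \<sigma> ^^ n) (prefix_of_word w (Suc m)) =
      (subst_word \<sigma> ^^ n) (prefix_of_word w m) @ \<tau> (w m)" for m
    by (simp add: prefix_of_word_def subst_word_funpow_append \<tau>_def)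
  have t_Suc: "t (Suc m) = t m + length (\<tau> (w m))" for m
    by (simp add: t_def split)
  have w_t: "w (t m + j) = \<tau> (w m) ! j" if "j < length (\<tau> (w m))" for m j
  proof -
    have "w (t m + j) = prefix_of_word w (t (Suc m)) ! (t m + j)"
      using that by (simp add: prefix_of_word_def t_Suc del: upt_Suc)
    also have "\<dots> = ((subst_word \<sigma> ^^ n) (prefix_of_word w (Suc m))) ! (t m + j)"
      using fixed_point_subst_word_funpow_prefix[OF assms(1,3), of n "Suc m"] by (simp add: t_def)
    also have "\<dots> = \<tau> (w m) ! j"
      by (simp add: split t_def nth_append)
    finally show ?thesis .
  qed
  have t_ge: "m \<le> t m" for m
  proof (induction m)
    case (Suc m)
    then show ?case using \<tau>_pos[of "w m"] t_Suc[of m] by linarith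
  qed simp
  have t_0: "t 0 = 0"
    by (simp add: t_def prefix_of_word_def subst_word_funpow_Nil)
  have "\<exists>k\<ge>x. k < x + 2 * L \<and> w k = a" for a x
  proof -
    \<comment> \<open>The first block starting at or after \<open>x\<close>. The block before it, if
      any, starts before \<open>x\<close>, so the delay is at most \<open>L\<close>.\<close>
    define m where "m = (LEAST m. x \<le> t m)"
    have m: "x \<le> t m" unfolding m_def by (rule LeastI[of _ x]) (rule t_ge)
    have "t m \<le> x + L"
    proof (cases m)
      case (Suc l)
      then have "t l < x" using not_less_Least[of l "\<lambda>m. x \<le> t m"] by (simp add: m_def)
      then show ?thesis using Suc t_Suc[of l] \<tau>_le[of "w l"] by simp
    qed (simp add: t_0)
    moreover obtain j where "j < length (\<tau> (w m))" "\<tau> (w m) ! j = a"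
      using n[of a "w m"] by (auto simp: \<tau>_def in_set_conv_nth)
    ultimately show ?thesis
      using m w_t[of j m] \<tau>_le[of "w m"] by (intro exI[of _ "t m + j"]) auto
  qed
  then show ?thesis by blast
qed

subsection \<open>Algebraicity over the rational functions\<close>

lemma map_poly_of_rat_mult:
  "map_poly of_rat (p * q) = (map_poly of_rat p * map_poly of_rat q :: complex poly)"
  by (rule poly_eqI) (simp add: coeff_map_poly coeff_mult of_rat_sum of_rat_mult)

text \<open>The embedding of rational polynomials into complex power series is injective, so the
  leading coefficient in the outer variable stays nonzero.\<close>

lemma algebraic_over_QX_relation:
  assumes "algebraic_over_QX f"
  obtains A :: "nat \<Rightarrow> complex poly" and d where
    "A d \<noteq> 0" "(\<Sum>i\<le>d. fps_of_poly (A i) * f ^ i) = 0"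
proof -
  let ?h = "\<lambda>q :: rat poly. fps_of_poly (map_poly of_rat q :: complex poly)"
  obtain p where p: "p \<noteq> 0" "poly (map_poly ?h p) f = 0"
    using assms by (auto simp: algebraic_over_QX_def)
  have h_0: "?h q = 0 \<longleftrightarrow> q = 0" for q
    by (auto simp: fps_eq_iff poly_eq_iff coeff_map_poly)
  have "degree (map_poly ?h p) = degree p"
    by (rule degree_map_poly) (simp add: h_0)
  then have "(\<Sum>i\<le>degree p. ?h (coeff p i) * f ^ i) = 0"
    using p(2) by (simp add: poly_altdef coeff_map_poly)
  moreover have "map_poly of_rat (coeff p (degree p)) \<noteq> (0 :: complex poly)"
    using p(1) h_0[of "coeff p (degree p)"] by auto
  ultimately show thesis
    by (rule that[rotated])
qed

text \<open>Multiplying the relation for \<open>f\<close> by \<open>u ^ d\<close> gives one for the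
  product of \<open>u\<close> and \<open>f\<close>, with coefficients
  \<open>A i * u ^ (d - i)\<close>; the leading one is unchanged.\<close>

lemma algebraic_multiple_imp_eventually_periodic:
  assumes alg: "algebraic_over_QX f" and "u \<noteq> 0"
    and fin: "finite (range (fps_nth (fps_of_poly u * f)))"
  shows "eventually_periodic (fps_nth (fps_of_poly u * f))"
proof -
  obtain A :: "nat \<Rightarrow> complex poly" and d where
    A: "A d \<noteq> 0" and rel: "(\<Sum>i\<le>d. fps_of_poly (A i) * f ^ i) = 0"
    using alg by (rule algebraic_over_QX_relation)
  let ?A = "\<lambda>i. A i * u ^ (d - i)"
  have "(\<Sum>i\<le>d. fps_of_poly (?A i) * (fps_of_poly u * f) ^ i) =
      (\<Sum>i\<le>d. fps_of_poly u ^ d * (fps_of_poly (A i) * f ^ i))"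
  proof (rule sum.cong)
    fix i assume "i \<in> {..d}"
    then have "fps_of_poly u ^ d = fps_of_poly u ^ (d - i) * fps_of_poly u ^ i"
      by (simp flip: power_add)
    then show "fps_of_poly (?A i) * (fps_of_poly u * f) ^ i = fps_of_poly u ^ d * (fps_of_poly (A i) * f ^ i)"
      by (simp add: fps_of_poly_mult fps_of_poly_power power_mult_distrib mult_ac)
  qed simp
  also have "\<dots> = 0"
    by (simp add: rel flip: sum_distrib_left)
  finally show ?thesis
    by (rule algebraic_finite_range_imp_eventually_periodic[where A = ?A, OF fin, rotated]) (use A in simp)
qed

text \<open>The annihilating polynomial is linear in the outer variable, with coefficients
  \<open>- r\<close> and \<open>q\<close>.\<close>

lemma rational_imp_algebraic_over_QX:
  fixes q r :: "rat poly"
  assumes "q \<noteq> 0" and eq: "fps_of_poly (map_poly of_rat q) * f = fps_of_poly (map_poly of_rat r)"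
  shows "algebraic_over_QX f"
proof -
  have "poly (map_poly (\<lambda>q. fps_of_poly (map_poly of_rat q)) [:- r, q:]) f =
      fps_of_poly (map_poly of_rat (- r)) + f * fps_of_poly (map_poly of_rat q)"
    using \<open>q \<noteq> 0\<close> by (simp add: map_poly_pCons)
  also have "map_poly of_rat (- r) = - (map_poly of_rat r :: complex poly)"
    by (rule poly_eqI) (simp add: coeff_map_poly of_rat_minus)
  finally have "poly (map_poly (\<lambda>q. fps_of_poly (map_poly of_rat q)) [:- r, q:]) f = 0"
    using eq by (simp add: fps_of_poly_uminus mult.commute)
  moreover have "[:- r, q:] \<noteq> 0" using \<open>q \<noteq> 0\<close> by simp
  ultimately show ?thesis
    unfolding algebraic_over_QX_def by blast
qed

text \<open>Multiplication by \<open>1 - X ^ d\<close> turns the series of \<open>c\<close> into a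
  polynomial, so \<open>f\<close> is even rational.\<close>

lemma eventually_periodic_multiple_imp_algebraic:
  fixes u :: "rat poly" and c :: "nat \<Rightarrow> nat"
  assumes "u \<noteq> 0" and eq: "fps_of_poly (map_poly of_rat u) * f = Abs_fps (\<lambda>n. of_nat (c n))"
    and "eventually_periodic c"
  shows "algebraic_over_QX f"
proof -
  obtain N d where d: "d \<ge> 1" and per: "\<And>n. n \<ge> N \<Longrightarrow> c (n + d) = c n"
    using assms by (auto simp: eventually_periodic_def)
  \<comment> \<open>The coefficients after multiplication by \<open>1 - X ^ d\<close>; the case
    \<open>n < d\<close> keeps the truncated difference from producing \<open>c 0\<close>.\<close>
  define e :: "nat \<Rightarrow> rat" where "e n = of_nat (c n) - (if n < d then 0 else of_nat (c (n - d)))" for n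
  have "e n = 0" if "n > N + d" for n
    using per[of "n - d"] that by (simp add: e_def)
  then have coeff_e: "coeff (Abs_poly e) = e"
    by (intro coeff_Abs_poly) auto
  define v :: "rat poly" where "v = 1 - monom 1 d"
  have "coeff v 0 = 1" using d by (simp add: v_def)
  then have "v \<noteq> 0" by auto
  have v: "map_poly of_rat v = (1 - monom 1 d :: complex poly)"
    by (rule poly_eqI) (simp add: v_def coeff_map_poly of_rat_diff)
  have "fps_of_poly (map_poly of_rat (v * u)) * f = (1 - fps_X ^ d) * Abs_fps (\<lambda>n. of_nat (c n))"
    by (simp add: map_poly_of_rat_mult fps_of_poly_mult mult.assoc eq v fps_of_poly_diff fps_of_poly_monom')
  also have "\<dots> = fps_of_poly (map_poly of_rat (Abs_poly e))"
    by (rule fps_ext)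
      (simp add: left_diff_distrib fps_X_power_mult_nth coeff_map_poly coeff_e e_def of_rat_diff)
  finally show ?thesis
    by (rule rational_imp_algebraic_over_QX[rotated]) (use \<open>u \<noteq> 0\<close> \<open>v \<noteq> 0\<close> in simp)
qed

text \<open>The multiplier is there because the position series has unbounded coefficients, unlike its
  product with 1 - X.\<close>

lemma algebraic_over_QX_iff_eventually_periodic:
  fixes u :: "rat poly" and c :: "nat \<Rightarrow> nat"
  assumes "u \<noteq> 0" and eq: "fps_of_poly (map_poly of_rat u) * f = Abs_fps (\<lambda>n. of_nat (c n))"
    and "finite (range c)"
  shows "algebraic_over_QX f \<longleftrightarrow> eventually_periodic c"
proof
  assume alg: "algebraic_over_QX f"
  have "map_poly of_rat u \<noteq> (0 :: complex poly)"
    using \<open>u \<noteq> 0\<close> by (auto simp: poly_eq_iff coeff_map_poly)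
  moreover have "fps_nth (fps_of_poly (map_poly of_rat u) * f) = (\<lambda>n. of_nat (c n))"
    by (simp add: eq fun_eq_iff)
  moreover from assms(3) have "finite (range (\<lambda>n. complex_of_nat (c n)))"
    using finite_imageI[of "range c" complex_of_nat] by (simp add: image_image)
  ultimately have "eventually_periodic (\<lambda>n. complex_of_nat (c n))"
    using algebraic_multiple_imp_eventually_periodic[OF alg] by metis
  then show "eventually_periodic c"
    by (subst (asm) eventually_periodic_comp_inj_on) (auto simp: inj_on_def)
qed (rule eventually_periodic_multiple_imp_algebraic[OF assms(1,2)])

section \<open>The two series of a letter\<close>

lemma algebraic_char_series_iff:
  "algebraic_over_QX (char_series w a) \<longleftrightarrow> eventually_periodic (\<lambda>n. w n = a)"
proof -
  have "algebraic_over_QX (char_series w a) \<longleftrightarrow> eventually_periodic (\<lambda>n. of_bool (w n = a) :: nat)"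
  proof (rule algebraic_over_QX_iff_eventually_periodic[where u = 1])
    show "fps_of_poly (map_poly of_rat 1) * char_series w a = Abs_fps (\<lambda>n. of_nat (of_bool (w n = a)))"
      by (simp add: char_series_def fps_eq_iff)
    show "finite (range (\<lambda>n. of_bool (w n = a) :: nat))"
      by (rule finite_subset[of _ "{0, 1}"]) auto
  qed simp
  also have "\<dots> \<longleftrightarrow> eventually_periodic (\<lambda>n. w n = a)"
    by (rule eventually_periodic_comp_inj_on) (auto simp: inj_on_def)
  finally show ?thesis .
qed

text \<open>Bounded gaps make the coefficients of \<open>(1 - X) P\<close> finite in number, and
  these are the gaps up to two initial terms, which do not affect eventual periodicity.\<close>

lemma algebraic_pos_series_iff:
  assumes gaps: "\<And>m. \<exists>k\<ge>m. k < m + G \<and> w k = a"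
  shows "algebraic_over_QX (pos_series w a) \<longleftrightarrow> eventually_periodic (\<lambda>n. w n = a)"
proof -
  define E where "E = {m. w m = a}"
  let ?p = "enumerate E"
  have inf: "infinite E"
    unfolding E_def infinite_nat_iff_unbounded_le using gaps by blast
  \<comment> \<open>Occurrences are counted from 1 but enumerated from 0: the term at 1 is the first
    position itself, and gaps begin at \<open>n = 2\<close>.\<close>
  define c where "c n = (if n = 0 then 0 else if n = 1 then ?p 0 else ?p (n - 1) - ?p (n - 2))" for n
  have "?p (Suc n) - ?p n \<le> G" for n
  proof -
    obtain k where k: "k \<ge> Suc (?p n)" "k < Suc (?p n) + G" "w k = a"
      using gaps by blast
    have "?p (Suc n) \<le> k"
      unfolding enumerate_Suc''[OF inf] by (rule Least_le) (use k in \<open>auto simp: E_def\<close>)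
    with k show ?thesis by simp
  qed
  then have "c (Suc (Suc n)) \<le> G" for n
    by (simp add: c_def)
  then have "c n \<le> max G (?p 0)" for n
    by (cases n; cases "n - 1") (auto simp: c_def le_max_iff_disj)
  then have "finite (range c)"
    by (intro finite_subset[of "range c" "{..max G (?p 0)}"]) auto
  moreover have "fps_of_poly (map_poly of_rat [:1, -1:]) * pos_series w a = Abs_fps (\<lambda>n. of_nat (c n))"
  proof (rule fps_ext)
    fix n
    have "fps_of_poly (map_poly of_rat [:1, -1:]) = (1 - fps_X :: complex fps)"
      by (simp add: map_poly_pCons of_rat_minus fps_of_poly_pCons)
    moreover have "fps_nth ((1 - fps_X) * pos_series w a) n = of_nat (c n)"
    proof (cases "n \<le> 1")
      case True
      then have "n = 0 \<or> n = 1" by auto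
      then show ?thesis
        by (auto simp: left_diff_distrib pos_series_def occ_pos_def c_def E_def)
    next
      case False
      then obtain m where "n = Suc (Suc m)"
        by (metis One_nat_def not0_implies_Suc not_less_eq_eq le0)
      moreover have "?p m \<le> ?p (Suc m)"
        using enumerate_step[OF inf] less_imp_le by blast
      ultimately show ?thesis
        by (simp add: left_diff_distrib pos_series_def occ_pos_def c_def of_nat_diff flip: E_def)
    qed
    ultimately show "fps_nth (fps_of_poly (map_poly of_rat [:1, -1:]) * pos_series w a) n =
        fps_nth (Abs_fps (\<lambda>n. of_nat (c n))) n"
      by (simp only: fps_nth_Abs_fps)
  qed
  ultimately have "algebraic_over_QX (pos_series w a) \<longleftrightarrow> eventually_periodic c"
    by (intro algebraic_over_QX_iff_eventually_periodic[where u = "[:1, -1:]"]) auto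
  also have "\<dots> \<longleftrightarrow> eventually_periodic (\<lambda>n. c (n + 2))"
    by (rule eventually_periodic_shift[symmetric])
  also have "(\<lambda>n. c (n + 2)) = (\<lambda>n. ?p (Suc n) - ?p n)"
    by (simp add: c_def fun_eq_iff)
  also have "eventually_periodic \<dots> \<longleftrightarrow> eventually_periodic (\<lambda>n. w n = a)"
    using eventually_periodic_enumerate_diff_iff[OF inf] by (simp add: E_def)
  finally show ?thesis .
qed

text \<open>Exempting a first non-periodic letter in
  \<open>eventually_periodic_if_indicators\<close> yields a second one.\<close>

lemma not_eventually_periodic_iff_two_letters:
  fixes w :: "nat \<Rightarrow> 'a::finite"
  shows "\<not> eventually_periodic w \<longleftrightarrow>
    (\<exists>a b. a \<noteq> b \<and> \<not> eventually_periodic (\<lambda>n. w n = a) \<and> \<not> eventually_periodic (\<lambda>n. w n = b))"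
    and "\<not> eventually_periodic w \<longleftrightarrow> (\<exists>a. \<not> eventually_periodic (\<lambda>n. w n = a))"
proof -
  have letter: "eventually_periodic (\<lambda>n. w n = a)" if "eventually_periodic w" for a
    using that unfolding eventually_periodic_def by metis
  show "\<not> eventually_periodic w \<longleftrightarrow>
    (\<exists>a b. a \<noteq> b \<and> \<not> eventually_periodic (\<lambda>n. w n = a) \<and> \<not> eventually_periodic (\<lambda>n. w n = b))"
    and "\<not> eventually_periodic w \<longleftrightarrow> (\<exists>a. \<not> eventually_periodic (\<lambda>n. w n = a))"
    using letter eventually_periodic_if_indicators[of _ w] by metis+
qed

text \<open>Statement (i) is linked to each of the other four. The letters carry no order, and the
  conditions are symmetric, so \<open>a \<noteq> b\<close> stands for \<open>i < j\<close>.\<close>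

theorem theorem4p2:
  fixes \<sigma> :: "'a::finite \<Rightarrow> 'a list" and w :: "nat \<Rightarrow> 'a"
  assumes "card (UNIV :: 'a set) \<ge> 2"
    and "is_substitution \<sigma>"
    and "primitive_subst \<sigma>"
    and "subst_inf \<sigma> w = w"
  shows "(\<not> eventually_periodic w \<longleftrightarrow> (\<exists>a. transcendental_over_QX (char_series w a)))
       \<and> (\<not> eventually_periodic w \<longleftrightarrow>
            (\<exists>a b. a \<noteq> b \<and> transcendental_over_QX (char_series w a)
                          \<and> transcendental_over_QX (char_series w b)))
       \<and> (\<not> eventually_periodic w \<longleftrightarrow> (\<exists>a. transcendental_over_QX (pos_series w a)))
       \<and> (\<not> eventually_periodic w \<longleftrightarrow>
            (\<exists>a b. a \<noteq> b \<and> transcendental_over_QX (pos_series w a)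
                          \<and> transcendental_over_QX (pos_series w b)))"
proof -
  obtain G where "\<And>a m. \<exists>k\<ge>m. k < m + G \<and> w k = a"
    using primitive_fixed_point_bounded_gaps[OF assms(2-4)] by blast
  then have "algebraic_over_QX (pos_series w a) \<longleftrightarrow> eventually_periodic (\<lambda>n. w n = a)" for a
    by (rule algebraic_pos_series_iff)
  then show ?thesis
    unfolding transcendental_over_QX_def algebraic_char_series_iff
    using not_eventually_periodic_iff_two_letters[of w] by simp
qed

end
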